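(* Let $G$ be a unimodular locally compact group and $\Gamma\subset G$. Let $\mathcal{H}\subset L^2(G)$ be a closed left-invariant subspace consisting of continuous functions, and assume that there is a constant $c_{\mathcal{H}}>0$ such that $\sum_{\gamma\in\Gamma}|f(\gamma)|^2 = c_{\mathcal{H}}\|f\|_2^2$ for all $f\in\mathcal{H}$. Then $\mathcal{H}$ is a sampling space with respect to $\Gamma$. More precisely, there exists a selfadjoint convolution idempotent $S\in L^2(G)$ such that $\frac{1}{c_{\mathcal{H}}}S$ is the associated sinc-type function for $\mathcal{H}$, and in addition $\mathcal{H} = L^2(G)*S$. In particular, $$ f(\gamma) = \langle f,\lambda_G(\gamma)S\rangle \quad\text{for all } f\in\mathcal{H},\ \gamma\in\Gamma, $$ and thus $\lambda_G(\Gamma)S = (\lambda_G(\gamma)S)_{\gamma\in\Gamma}$ is a tight frame for $\mathcal{H}$. The restriction map $R_\Gamma:\mathcal{H}\to\ell^2(\Gamma)$, $f\mapsto (f(\gamma))_{\gamma\in\Gamma}$, is onto if and only if $\lambda_G(\Gamma)S$ is an orthonormal basis of $\mathcal{H}$.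
   Context: $L^2(G)$ is taken with respect to left Haar measure $\mu_G$; $\lambda_G$ is left translation, $(\lambda_G(x)f)(y) = f(x^{-1}y)$; $g^*(x) = \overline{g(x^{-1})}$; $(f*g)(x) = \int_G f(y)g(y^{-1}x)\,d\mu_G(y)$. A subspace is left-invariant if it is invariant under $\lambda_G$. Sampling space: let $\Gamma\subset G$ and let $\mathcal{H}\subset L^2(G)$ be a closed left-invariant subspace consisting of continuous functions. $\mathcal{H}$ is a sampling space with respect to $\Gamma$ if (i) there is a constant $c_{\mathcal{H}}>0$ with $\sum_{\gamma\in\Gamma}|f(\gamma)|^2 = c_{\mathcal{H}}\|f\|_2^2$ for all $f\in\mathcal{H}$; and (ii) there exists $T\in\mathcal{H}$ such that every $f\in\mathcal{H}$ has the expansion $f(x) = \sum_{\gamma\in\Gamma} f(\gamma)T(\gamma^{-1}x)$, with convergence both in $L^2$ and uniformly. The function $T$ in (ii) is called a sinc-type function. A selfadjoint convolution idempotent is $S\in L^2(G)$ with $S = S*S = S^*$; then $f\mapsto f*S$ is the orthogonal projection of $L^2(G)$ onto a closed left-invariant subspace, denoted $L^2(G)*S$. A family $(\eta_i)_{i\in I}$ in a Hilbert space $\mathcal{K}$ is a tight frame if there is $c>0$ with $\sum_i|\langle\varphi,\eta_i\rangle|^2 = c\|\varphi\|^2$ for all $\varphi\in\mathcal{K}$.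
   Formalization: The last equivalence is false unless c_H = 1 (G = Z/2, H = constants, Γ = {0}); it is proved with the normalized family c_H^{-1/2} λ_G(Γ)S as the orthonormal basis, literally when c_H = 1, and "λ_G(Γ)S orthonormal basis implies R_Γ onto" for every c_H. *)

theory Defs
  imports "HOL-Analysis.Analysis"
begin

text \<open>
  The group is written additively because \<^class>\<open>topological_group_add\<close> is the library's class of
  topological groups.  It is \<^emph>\<open>not\<close> commutative: the class extends \<^class>\<open>group_add\<close>, not
  \<open>ab_group_add\<close>.  So \<open>x + y\<close> stands for the product \<open>xy\<close>, \<open>- x\<close> for \<open>x\<inverse>\<close>, and \<open>0\<close> for the
  identity; the order of the summands matters throughout.

  Elements of \<open>L\<^sup>2\<close> are represented by Borel measurable functions, and equality in \<open>L\<^sup>2\<close> is equality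
  almost everywhere.  A space \<open>H\<close> of continuous functions is the set of the continuous
  representatives of its elements, which are unique because nonempty open sets have positive Haar
  measure.
\<close>

section \<open>Haar measure\<close>

text \<open>A nonzero left-invariant Radon measure on the Borel sets.\<close>

definition left_haar_measure :: "'g::{topological_group_add,t2_space} measure \<Rightarrow> bool" where
  "left_haar_measure \<mu> \<longleftrightarrow>
     sets \<mu> = sets borel \<and>
     emeasure \<mu> (space \<mu>) \<noteq> 0 \<and>
     (\<forall>K. compact K \<longrightarrow> emeasure \<mu> K < \<infinity>) \<and>
     (\<forall>A\<in>sets borel. emeasure \<mu> A = (INF U\<in>{U. open U \<and> A \<subseteq> U}. emeasure \<mu> U)) \<and>
     (\<forall>U. open U \<longrightarrow> emeasure \<mu> U = (SUP K\<in>{K. compact K \<and> K \<subseteq> U}. emeasure \<mu> K)) \<and>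
     (\<forall>x. \<forall>A\<in>sets borel. emeasure \<mu> ((\<lambda>y. x + y) ` A) = emeasure \<mu> A)"

text \<open>For a left Haar measure \<open>\<mu>\<close>, this says that the modular function of the group is constantly 1.\<close>

definition unimodular :: "'g::{topological_group_add,t2_space} measure \<Rightarrow> bool" where
  "unimodular \<mu> \<longleftrightarrow> (\<forall>x. \<forall>A\<in>sets borel. emeasure \<mu> ((\<lambda>y. y + x) ` A) = emeasure \<mu> A)"

section \<open>The space \<open>L\<^sup>2\<close>\<close>

definition L2 :: "'a measure \<Rightarrow> ('a \<Rightarrow> complex) set" where
  "L2 \<mu> = {f \<in> borel_measurable \<mu>. integrable \<mu> (\<lambda>x. (cmod (f x))\<^sup>2)}"

definition L2_inner :: "'a measure \<Rightarrow> ('a \<Rightarrow> complex) \<Rightarrow> ('a \<Rightarrow> complex) \<Rightarrow> complex" where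
  "L2_inner \<mu> f g = (LINT x|\<mu>. f x * cnj (g x))"

definition L2_norm :: "'a measure \<Rightarrow> ('a \<Rightarrow> complex) \<Rightarrow> real" where
  "L2_norm \<mu> f = sqrt (LINT x|\<mu>. (cmod (f x))\<^sup>2)"

definition L2_closed_subspace :: "'a measure \<Rightarrow> ('a \<Rightarrow> complex) set \<Rightarrow> bool" where
  "L2_closed_subspace \<mu> H \<longleftrightarrow>
     H \<subseteq> L2 \<mu> \<and>
     (\<lambda>x. 0) \<in> H \<and>
     (\<forall>f\<in>H. \<forall>g\<in>H. (\<lambda>x. f x + g x) \<in> H) \<and>
     (\<forall>a. \<forall>f\<in>H. (\<lambda>x. a * f x) \<in> H) \<and>
     (\<forall>u f. (\<forall>n::nat. u n \<in> H) \<and> f \<in> L2 \<mu> \<and> (\<lambda>n. L2_norm \<mu> (\<lambda>x. u n x - f x)) \<longlonglongrightarrow> 0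
        \<longrightarrow> (\<exists>h\<in>H. AE x in \<mu>. h x = f x))"

section \<open>Translation, involution and convolution\<close>

definition ltrans :: "'g::group_add \<Rightarrow> ('g \<Rightarrow> complex) \<Rightarrow> 'g \<Rightarrow> complex" where
  "ltrans x f = (\<lambda>y. f (- x + y))"

definition involution :: "('g::group_add \<Rightarrow> complex) \<Rightarrow> 'g \<Rightarrow> complex" where
  "involution g = (\<lambda>x. cnj (g (- x)))"

definition conv :: "'g::group_add measure \<Rightarrow> ('g \<Rightarrow> complex) \<Rightarrow> ('g \<Rightarrow> complex) \<Rightarrow> 'g \<Rightarrow> complex" where
  "conv \<mu> f g = (\<lambda>x. LINT y|\<mu>. f y * g (- y + x))"

definition left_invariant :: "('g::group_add \<Rightarrow> complex) set \<Rightarrow> bool" where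
  "left_invariant H \<longleftrightarrow> (\<forall>x. \<forall>f\<in>H. ltrans x f \<in> H)"

definition sa_conv_idempotent :: "'g::group_add measure \<Rightarrow> ('g \<Rightarrow> complex) \<Rightarrow> bool" where
  "sa_conv_idempotent \<mu> S \<longleftrightarrow>
     S \<in> L2 \<mu> \<and> (AE x in \<mu>. S x = conv \<mu> S S x) \<and> (AE x in \<mu>. S x = involution S x)"

text \<open>
  The space \<open>L\<^sup>2(G) * S\<close>.  For a selfadjoint convolution idempotent \<open>S\<close> the convolutions
  \<open>f * S\<close> are continuous, so these functions are the continuous representatives.
\<close>

definition L2_conv :: "'g::group_add measure \<Rightarrow> ('g \<Rightarrow> complex) \<Rightarrow> ('g \<Rightarrow> complex) set" where
  "L2_conv \<mu> S = (\<lambda>f. conv \<mu> f S) ` L2 \<mu>"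

section \<open>Sampling spaces\<close>

definition closed_left_invariant_continuous ::
    "'g::{topological_group_add,t2_space} measure \<Rightarrow> ('g \<Rightarrow> complex) set \<Rightarrow> bool" where
  "closed_left_invariant_continuous \<mu> H \<longleftrightarrow>
     L2_closed_subspace \<mu> H \<and> left_invariant H \<and> (\<forall>f\<in>H. continuous_on UNIV f)"

definition sampling_identity ::
    "'g measure \<Rightarrow> 'g set \<Rightarrow> ('g \<Rightarrow> complex) set \<Rightarrow> real \<Rightarrow> bool" where
  "sampling_identity \<mu> \<Gamma> H c \<longleftrightarrow>
     (\<forall>f\<in>H. ((\<lambda>\<gamma>. (cmod (f \<gamma>))\<^sup>2) has_sum c * (L2_norm \<mu> f)\<^sup>2) \<Gamma>)"

text \<open>
  The set \<open>\<Gamma>\<close> is unordered and possibly uncountable, so both modes of convergence of the expansion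
  are along the net of finite subsets of \<open>\<Gamma>\<close>.
\<close>

definition sinc_type ::
    "'g::group_add measure \<Rightarrow> 'g set \<Rightarrow> ('g \<Rightarrow> complex) set \<Rightarrow> ('g \<Rightarrow> complex) \<Rightarrow> bool" where
  "sinc_type \<mu> \<Gamma> H T \<longleftrightarrow>
     T \<in> H \<and>
     (\<forall>f\<in>H.
        ((\<lambda>F. L2_norm \<mu> (\<lambda>x. f x - (\<Sum>\<gamma>\<in>F. f \<gamma> * T (- \<gamma> + x)))) \<longlongrightarrow> 0) (finite_subsets_at_top \<Gamma>) \<and>
        uniform_limit UNIV (\<lambda>F x. \<Sum>\<gamma>\<in>F. f \<gamma> * T (- \<gamma> + x)) f (finite_subsets_at_top \<Gamma>))"

definition sampling_space ::
    "'g::{topological_group_add,t2_space} measure \<Rightarrow> 'g set \<Rightarrow> ('g \<Rightarrow> complex) set \<Rightarrow> bool" where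
  "sampling_space \<mu> \<Gamma> H \<longleftrightarrow>
     closed_left_invariant_continuous \<mu> H \<and>
     (\<exists>c>0. sampling_identity \<mu> \<Gamma> H c) \<and>
     (\<exists>T. sinc_type \<mu> \<Gamma> H T)"

section \<open>Frames, orthonormal bases and the restriction map\<close>

definition tight_frame ::
    "'a measure \<Rightarrow> ('a \<Rightarrow> complex) set \<Rightarrow> 'i set \<Rightarrow> ('i \<Rightarrow> 'a \<Rightarrow> complex) \<Rightarrow> bool" where
  "tight_frame \<mu> K I \<eta> \<longleftrightarrow>
     (\<forall>i\<in>I. \<eta> i \<in> K) \<and>
     (\<exists>c>0. \<forall>\<phi>\<in>K. ((\<lambda>i. (cmod (L2_inner \<mu> \<phi> (\<eta> i)))\<^sup>2) has_sum c * (L2_norm \<mu> \<phi>)\<^sup>2) I)"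

text \<open>An orthonormal family in \<open>K\<close> whose finite linear combinations are dense in \<open>K\<close>.\<close>

definition orthonormal_basis ::
    "'a measure \<Rightarrow> ('a \<Rightarrow> complex) set \<Rightarrow> 'i set \<Rightarrow> ('i \<Rightarrow> 'a \<Rightarrow> complex) \<Rightarrow> bool" where
  "orthonormal_basis \<mu> K I \<eta> \<longleftrightarrow>
     (\<forall>i\<in>I. \<eta> i \<in> K) \<and>
     (\<forall>i\<in>I. \<forall>j\<in>I. L2_inner \<mu> (\<eta> i) (\<eta> j) = (if i = j then 1 else 0)) \<and>
     (\<forall>f\<in>K. \<forall>\<epsilon>>0. \<exists>F a. finite F \<and> F \<subseteq> I \<and> L2_norm \<mu> (\<lambda>x. f x - (\<Sum>i\<in>F. a i * \<eta> i x)) < \<epsilon>)"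

definition ell2 :: "'i set \<Rightarrow> ('i \<Rightarrow> complex) set" where
  "ell2 I = {a \<in> extensional I. (\<lambda>i. (cmod (a i))\<^sup>2) summable_on I}"

definition restriction_map :: "'g set \<Rightarrow> ('g \<Rightarrow> complex) \<Rightarrow> 'g \<Rightarrow> complex" where
  "restriction_map \<Gamma> f = restrict f \<Gamma>"

end

theory Submission
  imports Defs
begin

text \<open>
  The sampling identity and left invariance bound every point evaluation on \<open>H\<close> by \<open>sqrt c \<parallel>f\<parallel>\<close>, so
  \<open>H\<close> is a reproducing kernel Hilbert space.  If \<open>S\<close> represents evaluation at the identity, then its
  translates represent the other evaluations: \<open>f x = \<langle>f, ltrans x S\<rangle>\<close>.  Applied to \<open>S\<close> this gives
  \<open>S = S\<^sup>*\<close>, whence \<open>\<langle>f, ltrans x S\<rangle> = (f * S) x\<close> for all \<open>f\<close> in \<open>L\<^sup>2\<close>, and \<open>f * S\<close> is the orthogonal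
  projection of \<open>f\<close> to \<open>H\<close>.  The sampling identity says that \<open>ltrans \<gamma> S\<close>, \<open>\<gamma> \<in> \<Gamma>\<close>, is a tight frame with
  constant \<open>c\<close>; its reconstruction formula is the sampling expansion.  The expansion also converges
  uniformly, because the evaluations are uniformly bounded.
\<close>

section \<open>The space \<open>L\<^sup>2\<close>\<close>

text \<open>The weight \<open>t = b / a\<close> turns the bound into \<open>2 * (a * b)\<close>.
  Estimates with a fixed weight can thus be integrated or summed first and optimised
  afterwards.\<close>

lemma le_mult_if_le_weighted_squares:
  fixes a b x :: real
  assumes "a \<ge> 0" "b \<ge> 0" and le: "\<And>t. t > 0 \<Longrightarrow> 2 * x \<le> t * a\<^sup>2 + b\<^sup>2 / t"
  shows "x \<le> a * b"
proof (cases "a = 0 \<or> b = 0")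
  case True
  have "x \<le> 0"
  proof (rule ccontr)
    assume "\<not> x \<le> 0"
    then have x: "x > 0" by simp
    show False
    proof (cases "a = 0")
      case True
      \<comment> \<open>The weight \<open>(b^2 + 1) / x\<close> brings the second term down to at
        most \<open>x\<close>; the added 1 keeps the weight positive when
        \<open>b = 0\<close>.\<close>
      have pos: "(b\<^sup>2 + 1) / x > 0"
        using x by (simp add: add_nonneg_pos)
      have "b\<^sup>2 / ((b\<^sup>2 + 1) / x) = x * (b\<^sup>2 / (b\<^sup>2 + 1))" by simp
      also have "\<dots> \<le> x * 1"
        using x by (intro mult_left_mono) (simp_all add: divide_le_eq add_nonneg_pos)
      finally have "2 * x \<le> x"
        using le[OF pos] True by simp
      then show False using x by simp
    next
      case False
      then have b: "b = 0" and a: "a > 0" using True assms(1) by auto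
      show False using le[of "x / a\<^sup>2"] a x b by simp
    qed
  qed
  then show ?thesis using assms by (simp add: mult_nonneg_nonneg order_trans)
next
  case False
  then have "a > 0" "b > 0" using assms by auto
  then show ?thesis using le[of "b / a"] by (simp add: power2_eq_square)
qed

lemma cmod_add_sq: "(cmod (x + y))\<^sup>2 = (cmod x)\<^sup>2 + 2 * Re (x * cnj y) + (cmod y)\<^sup>2"
  unfolding cmod_power2 by (simp add: power2_eq_square algebra_simps)

text \<open>AM-GM, read off from the square of \<open>sqrt t * cmod x - cmod y / sqrt t\<close>,
  whose cross term is free of \<open>t\<close>.\<close>

lemma cmod_mult_cnj_le: "t > 0 \<Longrightarrow> 2 * cmod (x * cnj y) \<le> t * (cmod x)\<^sup>2 + (cmod y)\<^sup>2 / t"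
proof -
  assume t: "t > 0"
  have "0 \<le> (sqrt t * cmod x - cmod y / sqrt t)\<^sup>2" by simp
  also have "\<dots> = t * (cmod x)\<^sup>2 + (cmod y)\<^sup>2 / t - 2 * (cmod x * cmod y)"
    using t by (simp add: power2_diff power_mult_distrib power_divide)
  finally show ?thesis by (simp add: norm_mult)
qed

lemma L2_measurable: "f \<in> L2 \<mu> \<Longrightarrow> f \<in> borel_measurable \<mu>"
  by (simp add: L2_def)

lemma integrable_L2: "f \<in> L2 \<mu> \<Longrightarrow> integrable \<mu> (\<lambda>x. (cmod (f x))\<^sup>2)"
  by (simp add: L2_def)

lemma integrable_mult_cnj_L2:
  assumes "f \<in> L2 \<mu>" "g \<in> L2 \<mu>"
  shows "integrable \<mu> (\<lambda>x. f x * cnj (g x))"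
proof (rule Bochner_Integration.integrable_bound)
  show "integrable \<mu> (\<lambda>x. (cmod (f x))\<^sup>2 + (cmod (g x))\<^sup>2)"
    using assms by (simp add: integrable_L2)
  have [measurable]: "f \<in> borel_measurable \<mu>" "g \<in> borel_measurable \<mu>"
    using assms by (auto simp: L2_def)
  show "(\<lambda>x. f x * cnj (g x)) \<in> borel_measurable \<mu>"
    by (intro borel_measurable_times borel_measurable_continuous_on[where f = cnj]) 
       (auto intro: continuous_intros)
  have "cmod (f x * cnj (g x)) \<le> (cmod (f x))\<^sup>2 + (cmod (g x))\<^sup>2" for x
    using cmod_mult_cnj_le[of 1 "f x" "g x"] norm_ge_zero[of "f x * cnj (g x)"] by linarith
  then show "AE x in \<mu>. cmod (f x * cnj (g x)) \<le> norm ((cmod (f x))\<^sup>2 + (cmod (g x))\<^sup>2)"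
    by auto
qed

lemma L2_add:
  assumes "f \<in> L2 \<mu>" "g \<in> L2 \<mu>"
  shows "(\<lambda>x. f x + g x) \<in> L2 \<mu>"
proof -
  have "integrable \<mu> (\<lambda>x. (cmod (f x))\<^sup>2 + 2 * Re (f x * cnj (g x)) + (cmod (g x))\<^sup>2)"
    using assms by (intro Bochner_Integration.integrable_add integrable_mult_right integrable_Re
      integrable_L2 integrable_mult_cnj_L2)
  then show ?thesis
    using assms by (auto simp: L2_def cmod_add_sq simp del: times_complex.sel)
qed

lemma L2_cmult: "f \<in> L2 \<mu> \<Longrightarrow> (\<lambda>x. a * f x) \<in> L2 \<mu>"
  by (auto simp: L2_def norm_mult power_mult_distrib intro: borel_measurable_times)

lemma L2_diff: "f \<in> L2 \<mu> \<Longrightarrow> g \<in> L2 \<mu> \<Longrightarrow> (\<lambda>x. f x - g x) \<in> L2 \<mu>"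
  using L2_add[OF _ L2_cmult[of g \<mu> "-1"]] by simp

lemma L2_norm_nonneg [simp]: "L2_norm \<mu> f \<ge> 0"
  by (simp add: L2_norm_def)

lemma L2_norm_sq: "(L2_norm \<mu> f)\<^sup>2 = (LINT x|\<mu>. (cmod (f x))\<^sup>2)"
  by (simp add: L2_norm_def)

lemma L2_inner_same: "L2_inner \<mu> f f = complex_of_real ((L2_norm \<mu> f)\<^sup>2)"
  by (simp add: L2_norm_sq L2_inner_def flip: complex_norm_square integral_complex_of_real)

lemma L2_inner_commute: "L2_inner \<mu> g f = cnj (L2_inner \<mu> f g)"
proof -
  have "L2_inner \<mu> g f = (LINT x|\<mu>. cnj (f x * cnj (g x)))"
    by (simp add: L2_inner_def mult.commute del: Bochner_Integration.integral_cnj)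
  also have "\<dots> = cnj (L2_inner \<mu> f g)"
    unfolding L2_inner_def by (rule Bochner_Integration.integral_cnj)
  finally show ?thesis .
qed

lemma L2_inner_add_left:
  "f \<in> L2 \<mu> \<Longrightarrow> g \<in> L2 \<mu> \<Longrightarrow> h \<in> L2 \<mu> \<Longrightarrow>
     L2_inner \<mu> (\<lambda>x. f x + g x) h = L2_inner \<mu> f h + L2_inner \<mu> g h"
  by (simp add: L2_inner_def distrib_right integrable_mult_cnj_L2)

lemma L2_inner_cmult_left: "L2_inner \<mu> (\<lambda>x. a * f x) h = a * L2_inner \<mu> f h"
  by (simp add: L2_inner_def mult.assoc)

lemma L2_inner_cmult_right: "L2_inner \<mu> h (\<lambda>x. a * f x) = cnj a * L2_inner \<mu> h f"
  by (subst (1 2) L2_inner_commute) (simp add: L2_inner_cmult_left)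

lemma L2_inner_diff_left:
  "f \<in> L2 \<mu> \<Longrightarrow> g \<in> L2 \<mu> \<Longrightarrow> h \<in> L2 \<mu> \<Longrightarrow>
     L2_inner \<mu> (\<lambda>x. f x - g x) h = L2_inner \<mu> f h - L2_inner \<mu> g h"
  by (simp add: L2_inner_def left_diff_distrib integrable_mult_cnj_L2)

lemma L2_inner_diff_right:
  "f \<in> L2 \<mu> \<Longrightarrow> g \<in> L2 \<mu> \<Longrightarrow> h \<in> L2 \<mu> \<Longrightarrow>
     L2_inner \<mu> h (\<lambda>x. f x - g x) = L2_inner \<mu> h f - L2_inner \<mu> h g"
  by (simp add: L2_inner_def right_diff_distrib integrable_mult_cnj_L2)

lemma L2_norm_add_sq:
  assumes "f \<in> L2 \<mu>" "g \<in> L2 \<mu>"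
  shows "(L2_norm \<mu> (\<lambda>x. f x + g x))\<^sup>2
    = (L2_norm \<mu> f)\<^sup>2 + 2 * Re (L2_inner \<mu> f g) + (L2_norm \<mu> g)\<^sup>2"
  using assms
  by (simp add: L2_norm_sq L2_inner_def cmod_add_sq integrable_L2 integrable_mult_cnj_L2
      integrable_Re integral_Re del: times_complex.sel)

lemma L2_norm_cmult: "L2_norm \<mu> (\<lambda>x. a * f x) = cmod a * L2_norm \<mu> f"
  by (simp add: L2_norm_def norm_mult power_mult_distrib real_sqrt_mult)

text \<open>The weighted AM-GM inequality is integrated for each fixed \<open>t\<close>; the weight
  is optimised only then.\<close>

lemma L2_Cauchy_Schwarz:
  assumes "f \<in> L2 \<mu>" "g \<in> L2 \<mu>"
  shows "cmod (L2_inner \<mu> f g) \<le> L2_norm \<mu> f * L2_norm \<mu> g"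
proof (rule le_mult_if_le_weighted_squares)
  fix t :: real assume t: "t > 0"
  have "2 * cmod (L2_inner \<mu> f g) \<le> 2 * (LINT x|\<mu>. cmod (f x * cnj (g x)))"
    unfolding L2_inner_def by simp
  also have "\<dots> = (LINT x|\<mu>. 2 * cmod (f x * cnj (g x)))" by simp
  also have "\<dots> \<le> (LINT x|\<mu>. t * (cmod (f x))\<^sup>2 + (cmod (g x))\<^sup>2 / t)"
  proof (rule integral_mono)
    show "integrable \<mu> (\<lambda>x. 2 * cmod (f x * cnj (g x)))"
      using integrable_mult_cnj_L2[OF assms] by (intro integrable_mult_right integrable_norm)
    show "integrable \<mu> (\<lambda>x. t * (cmod (f x))\<^sup>2 + (cmod (g x))\<^sup>2 / t)"
      using assms by (simp add: integrable_L2)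
  qed (rule cmod_mult_cnj_le[OF t])
  also have "\<dots> = t * (L2_norm \<mu> f)\<^sup>2 + (L2_norm \<mu> g)\<^sup>2 / t"
    using assms by (simp add: L2_norm_sq integrable_L2)
  finally show "2 * cmod (L2_inner \<mu> f g) \<le> t * (L2_norm \<mu> f)\<^sup>2 + (L2_norm \<mu> g)\<^sup>2 / t" .
qed simp_all

text \<open>Fatou's lemma for the squared moduli. It also places the limit in \<open>L2\<close>,
  which is what the completeness argument for \<open>H\<close> draws on.\<close>

lemma L2_pointwise_limit:
  assumes g: "\<And>n. g n \<in> L2 \<mu>"
    and lim: "\<And>x. x \<in> space \<mu> \<Longrightarrow> (\<lambda>n. g n x) \<longlonglongrightarrow> f x"
    and le: "\<forall>\<^sub>F n in sequentially. L2_norm \<mu> (g n) \<le> e" and "e \<ge> 0"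
  shows "f \<in> L2 \<mu>" and "L2_norm \<mu> f \<le> e"
proof -
  have f [measurable]: "f \<in> borel_measurable \<mu>"
    by (rule borel_measurable_LIMSEQ_metric[OF L2_measurable[OF g] lim])
  have [measurable]: "g n \<in> borel_measurable \<mu>" for n by (rule L2_measurable[OF g])
  have "(\<integral>\<^sup>+x. ennreal ((cmod (f x))\<^sup>2) \<partial>\<mu>)
      = (\<integral>\<^sup>+x. liminf (\<lambda>n. ennreal ((cmod (g n x))\<^sup>2)) \<partial>\<mu>)"
  proof (rule nn_integral_cong)
    fix x assume "x \<in> space \<mu>"
    then have "(\<lambda>n. ennreal ((cmod (g n x))\<^sup>2)) \<longlonglongrightarrow> ennreal ((cmod (f x))\<^sup>2)"
      by (intro tendsto_ennrealI tendsto_power tendsto_norm lim)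
    then show "ennreal ((cmod (f x))\<^sup>2) = liminf (\<lambda>n. ennreal ((cmod (g n x))\<^sup>2))"
      using lim_imp_Liminf[OF sequentially_bot] by metis
  qed
  also have "\<dots> \<le> liminf (\<lambda>n. \<integral>\<^sup>+x. ennreal ((cmod (g n x))\<^sup>2) \<partial>\<mu>)"
    by (rule nn_integral_liminf) measurable
  also have "\<dots> \<le> limsup (\<lambda>n. \<integral>\<^sup>+x. ennreal ((cmod (g n x))\<^sup>2) \<partial>\<mu>)"
    by (rule Liminf_le_Limsup) simp
  also have "\<dots> \<le> ennreal (e\<^sup>2)"
  proof (rule Limsup_bounded)
    show "\<forall>\<^sub>F n in sequentially. (\<integral>\<^sup>+x. ennreal ((cmod (g n x))\<^sup>2) \<partial>\<mu>) \<le> ennreal (e\<^sup>2)"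
      using le
    proof eventually_elim
      case (elim n)
      have "(\<integral>\<^sup>+x. ennreal ((cmod (g n x))\<^sup>2) \<partial>\<mu>) = ennreal ((L2_norm \<mu> (g n))\<^sup>2)"
        using integrable_L2[OF g] by (simp add: nn_integral_eq_integral L2_norm_sq)
      also have "\<dots> \<le> ennreal (e\<^sup>2)" using elim by (intro ennreal_leI power_mono) simp_all
      finally show ?case .
    qed
  qed
  finally have le: "(\<integral>\<^sup>+x. ennreal ((cmod (f x))\<^sup>2) \<partial>\<mu>) \<le> ennreal (e\<^sup>2)" .
  have int: "integrable \<mu> (\<lambda>x. (cmod (f x))\<^sup>2)"
  proof (rule integrableI_bounded)
    show "(\<integral>\<^sup>+x. ennreal (norm ((cmod (f x))\<^sup>2)) \<partial>\<mu>) < \<infinity>"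
      using le_less_trans[OF le, of \<infinity>] by simp
    show "(\<lambda>x. (cmod (f x))\<^sup>2) \<in> borel_measurable \<mu>" by measurable
  qed
  then show "f \<in> L2 \<mu>" using f by (simp add: L2_def)
  have "(L2_norm \<mu> f)\<^sup>2 \<le> e\<^sup>2"
    using le int by (simp add: nn_integral_eq_integral L2_norm_sq)
  then show "L2_norm \<mu> f \<le> e" using \<open>e \<ge> 0\<close> by (rule power2_le_imp_le)
qed

section \<open>Haar measure\<close>

text \<open>Invariance is defined through images of sets. The preimage of a set under translation by
  \<open>x\<close> is its image under translation by \<open>- x\<close>, so the push-forward is
  \<open>\<mu>\<close> itself and integrals can be transported.\<close>

lemma distr_left_haar_measure:
  fixes \<mu> :: "'g::{topological_group_add,t2_space} measure"
  assumes "left_haar_measure \<mu>"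
  shows "distr \<mu> \<mu> ((+) x) = \<mu>" and "(+) x \<in> measurable \<mu> \<mu>"
proof -
  have sets: "sets \<mu> = sets borel" using assms by (simp add: left_haar_measure_def)
  have "(+) x \<in> measurable (borel :: 'g measure) borel"
    by (intro borel_measurable_continuous_onI continuous_intros)
  then show meas: "(+) x \<in> measurable \<mu> \<mu>"
    using sets by (simp cong: measurable_cong_sets)
  show "distr \<mu> \<mu> ((+) x) = \<mu>"
  proof (rule measure_eqI)
    fix A assume "A \<in> sets (distr \<mu> \<mu> ((+) x))"
    then have A: "A \<in> sets \<mu>" by simp
    have "space \<mu> = UNIV" using sets_eq_imp_space_eq[OF sets] by simp
    moreover have "(+) x -` A = (\<lambda>y. - x + y) ` A"
      by (auto simp: image_iff add.assoc[symmetric] intro!: bexI[of _ "x + _"])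
    ultimately have "emeasure (distr \<mu> \<mu> ((+) x)) A = emeasure \<mu> ((\<lambda>y. - x + y) ` A)"
      using A meas by (simp add: emeasure_distr)
    also have "\<dots> = emeasure \<mu> A"
      using A assms sets by (simp add: left_haar_measure_def)
    finally show "emeasure (distr \<mu> \<mu> ((+) x)) A = emeasure \<mu> A" .
  qed simp
qed

lemma integral_left_translate:
  fixes f :: "'g::{topological_group_add,t2_space} \<Rightarrow> 'b::{banach,second_countable_topology}"
  assumes "left_haar_measure \<mu>" "f \<in> borel_measurable \<mu>"
  shows "(LINT y|\<mu>. f (x + y)) = (LINT y|\<mu>. f y)"
  using integral_distr[OF distr_left_haar_measure(2)[OF assms(1)] assms(2), of x]
    distr_left_haar_measure(1)[OF assms(1)] by simp

lemma L2_norm_ltrans: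
  assumes "left_haar_measure \<mu>" "f \<in> L2 \<mu>"
  shows "L2_norm \<mu> (ltrans x f) = L2_norm \<mu> f"
  using integral_left_translate[OF assms(1), of "\<lambda>y. (cmod (f y))\<^sup>2" "- x"]
    integrable_L2[OF assms(2)]
  by (simp add: L2_norm_def ltrans_def borel_measurable_integrable)

lemma L2_inner_ltrans:
  assumes "left_haar_measure \<mu>" "f \<in> L2 \<mu>" "g \<in> L2 \<mu>"
  shows "L2_inner \<mu> (ltrans x f) (ltrans x g) = L2_inner \<mu> f g"
  using integral_left_translate[OF assms(1), of "\<lambda>y. f y * cnj (g y)" "- x"]
    integrable_mult_cnj_L2[OF assms(2,3)]
  by (simp add: L2_inner_def ltrans_def borel_measurable_integrable)

lemma ltrans_ltrans: "ltrans x (ltrans y f) = ltrans (x + y) f"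
  by (simp add: ltrans_def minus_add add.assoc[symmetric])

text \<open>Finitely many translates of \<open>U\<close> cover any given compact set. A null
  \<open>U\<close> would make every compact set null and hence, by inner regularity, the whole
  group.\<close>

lemma emeasure_left_haar_measure_open:
  fixes \<mu> :: "'g::{topological_group_add,t2_space} measure"
  assumes "left_haar_measure \<mu>" and U: "open U" "U \<noteq> {}"
  shows "emeasure \<mu> U \<noteq> 0"
proof
  assume zero: "emeasure \<mu> U = 0"
  have sets: "sets \<mu> = sets borel" using assms by (simp add: left_haar_measure_def)
  obtain u where u: "u \<in> U" using U by auto
  define V where "V x = (\<lambda>y. x + y) ` U" for x
  have V_vimage: "V x = (\<lambda>y. - x + y) -` U" for x
    by (auto simp: V_def image_iff add.assoc[symmetric] intro!: bexI[of _ "- x + _"])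
  have V_open: "open (V x)" for x
    unfolding V_vimage by (intro open_vimage U continuous_intros)
  have V_null: "emeasure \<mu> (V x) = 0" for x
    using assms(1) U zero unfolding left_haar_measure_def V_def by auto
  have "emeasure \<mu> K = 0" if K: "compact K" for K
  proof -
    have "K \<subseteq> \<Union> (range V)"
    proof
      fix x
      have "x \<in> V (x - u)" using u by (simp add: V_vimage)
      then show "x \<in> \<Union> (range V)" by blast
    qed
    then obtain T where T: "T \<subseteq> range V" "finite T" "K \<subseteq> \<Union> T"
      by (rule compactE[OF K, of "range V"]) (use V_open in auto)
    have "V' \<in> null_sets \<mu>" if "V' \<in> T" for V'
      using that T V_null V_open sets by (auto simp: null_sets_def)
    then have "(\<Union>V'\<in>T. V') \<in> null_sets \<mu>"
      using T(2) by (intro null_sets.finite_UN) auto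
    then have "\<Union> T \<in> null_sets \<mu>" by simp
    then show ?thesis
      using T(3) emeasure_mono[of K "\<Union> T" \<mu>] by (auto simp: null_sets_def)
  qed
  then have "emeasure \<mu> UNIV = 0"
    using assms(1) unfolding left_haar_measure_def
    by (auto simp: image_constant_conv bot_ennreal intro!: SUP_eqI)
  moreover have "space \<mu> = UNIV" using sets_eq_imp_space_eq[OF sets] by simp
  ultimately show False using assms(1) by (simp add: left_haar_measure_def)
qed

text \<open>The set where \<open>f\<close> and \<open>g\<close> differ is open and null, hence
  empty. This upgrades the almost everywhere equality in the closedness of \<open>H\<close> to
  equality of functions.\<close>

lemma continuous_AE_eq_imp_eq:
  fixes f g :: "'g::{topological_group_add,t2_space} \<Rightarrow> complex"
  assumes haar: "left_haar_measure \<mu>"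
    and cont: "continuous_on UNIV f" "continuous_on UNIV g" and AE: "AE x in \<mu>. f x = g x"
  shows "f = g"
proof (rule ccontr)
  assume "f \<noteq> g"
  let ?U = "{x. f x \<noteq> g x}"
  have "open ?U" using cont by (rule open_Collect_neq)
  moreover from this have "?U \<in> sets \<mu>" using haar by (simp add: left_haar_measure_def)
  then have "emeasure \<mu> ?U = 0"
    using AE AE_iff_measurable[of ?U \<mu> "\<lambda>x. f x = g x"] haar
      sets_eq_imp_space_eq[of \<mu> borel] by (simp add: left_haar_measure_def)
  moreover have "?U \<noteq> {}" using \<open>f \<noteq> g\<close> by auto
  ultimately show False using emeasure_left_haar_measure_open[OF haar] by blast
qed

lemma continuous_L2_norm_0:
  fixes f :: "'g::{topological_group_add,t2_space} \<Rightarrow> complex"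
  assumes "left_haar_measure \<mu>" "f \<in> L2 \<mu>" "continuous_on UNIV f" "L2_norm \<mu> f = 0"
  shows "f = (\<lambda>x. 0)"
proof (rule continuous_AE_eq_imp_eq[OF assms(1,3)])
  have "(LINT x|\<mu>. (cmod (f x))\<^sup>2) = 0" using assms(4) by (simp add: L2_norm_def)
  then show "AE x in \<mu>. f x = 0"
    using integral_nonneg_eq_0_iff_AE[OF integrable_L2[OF assms(2)]] by simp
qed simp

section \<open>Subspaces satisfying a sampling identity\<close>

locale sampled_subspace =
  fixes \<mu> :: "'g::{topological_group_add,t2_space} measure"
    and \<Gamma> :: "'g set" and H :: "('g \<Rightarrow> complex) set" and c :: real
  assumes haar: "left_haar_measure \<mu>"
    and subspace: "closed_left_invariant_continuous \<mu> H"
    and c_pos: "c > 0"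
    and sampling: "sampling_identity \<mu> \<Gamma> H c"
begin

section \<open>Point evaluations, completeness and Riesz representation in \<open>H\<close>\<close>

lemma in_L2: "f \<in> H \<Longrightarrow> f \<in> L2 \<mu>"
  and zero: "(\<lambda>x. 0) \<in> H"
  and add: "f \<in> H \<Longrightarrow> g \<in> H \<Longrightarrow> (\<lambda>x. f x + g x) \<in> H"
  and cmult: "f \<in> H \<Longrightarrow> (\<lambda>x. a * f x) \<in> H"
  and translate: "f \<in> H \<Longrightarrow> ltrans y f \<in> H"
  and continuous: "f \<in> H \<Longrightarrow> continuous_on UNIV f"
  and has_sum_norm: "f \<in> H \<Longrightarrow> ((\<lambda>\<gamma>. (cmod (f \<gamma>))\<^sup>2) has_sum c * (L2_norm \<mu> f)\<^sup>2) \<Gamma>"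
  using subspace sampling
  unfolding closed_left_invariant_continuous_def L2_closed_subspace_def left_invariant_def
    sampling_identity_def by auto

lemma diff: "f \<in> H \<Longrightarrow> g \<in> H \<Longrightarrow> (\<lambda>x. f x - g x) \<in> H"
  using add[OF _ cmult[of g "-1"]] by simp

lemma sum_closed:
  "finite F \<Longrightarrow> (\<And>i. i \<in> F \<Longrightarrow> u i \<in> H) \<Longrightarrow> (\<lambda>x. \<Sum>i\<in>F. u i x) \<in> H"
  by (induction F rule: finite_induct) (simp_all add: zero add)

lemma closed:
  assumes "\<And>n::nat. u n \<in> H" "f \<in> L2 \<mu>" "(\<lambda>n. L2_norm \<mu> (\<lambda>x. u n x - f x)) \<longlonglongrightarrow> 0"
  shows "\<exists>h\<in>H. AE x in \<mu>. h x = f x"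
  using assms subspace
  unfolding closed_left_invariant_continuous_def L2_closed_subspace_def by blast

lemma norm_0_imp_zero: "f \<in> H \<Longrightarrow> L2_norm \<mu> f = 0 \<Longrightarrow> f = (\<lambda>x. 0)"
  using continuous_L2_norm_0[OF haar in_L2 continuous] .

text \<open>A translation moves the value at \<open>x\<close> to a point of \<open>\<Gamma>\<close>,
  where a single term is at most the whole sum. It preserves the norm, so the constant does not
  depend on \<open>x\<close>.\<close>

lemma cmod_le_L2_norm:
  assumes f: "f \<in> H"
  shows "cmod (f x) \<le> sqrt c * L2_norm \<mu> f"
proof (cases "\<Gamma> = {}")
  \<comment> \<open>Without sampling points the sum is 0, which forces the norm of \<open>f\<close>
    and hence \<open>f\<close> to vanish.\<close>
  case True
  then have "c * (L2_norm \<mu> f)\<^sup>2 = 0"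
    using has_sum_norm[OF f] has_sum_empty has_sum_unique by metis
  then show ?thesis using c_pos norm_0_imp_zero[OF f] by simp
next
  case False
  then obtain \<gamma> where \<gamma>: "\<gamma> \<in> \<Gamma>" by auto
  define g where "g = ltrans (\<gamma> - x) f"
  have "g \<gamma> = f x" by (simp add: g_def ltrans_def)
  moreover have "g \<in> H" using f by (simp add: g_def translate)
  then have "(cmod (g \<gamma>))\<^sup>2 \<le> c * (L2_norm \<mu> g)\<^sup>2"
    using finite_sum_le_has_sum[OF has_sum_norm, of g "{\<gamma>}"] \<gamma> by simp
  moreover have "L2_norm \<mu> g = L2_norm \<mu> f"
    unfolding g_def by (rule L2_norm_ltrans[OF haar in_L2[OF f]])
  ultimately have "(cmod (f x))\<^sup>2 \<le> (sqrt c * L2_norm \<mu> f)\<^sup>2"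
    using c_pos by (simp add: power_mult_distrib)
  then show ?thesis by (rule power2_le_imp_le) (simp add: c_pos less_imp_le)
qed

text \<open>By the previous bound, a Cauchy sequence of \<open>H\<close> converges uniformly, which gives the limit a
  continuous representative without an appeal to the completeness of \<open>L\<^sup>2\<close>.\<close>

lemma complete:
  assumes u: "\<And>n::nat. u n \<in> H"
    and Cauchy: "\<And>e. e > 0 \<Longrightarrow> \<exists>N. \<forall>m\<ge>N. \<forall>n\<ge>N. L2_norm \<mu> (\<lambda>x. u m x - u n x) < e"
  obtains f where "f \<in> H" "(\<lambda>n. L2_norm \<mu> (\<lambda>x. u n x - f x)) \<longlonglongrightarrow> 0"
proof -
  have "uniformly_Cauchy_on UNIV u"
    unfolding uniformly_Cauchy_on_def
  proof (intro allI impI)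
    fix e :: real assume "e > 0"
    then have "e / sqrt c > 0" using c_pos by simp
    then obtain N where N: "\<And>m n. m \<ge> N \<Longrightarrow> n \<ge> N \<Longrightarrow> L2_norm \<mu> (\<lambda>x. u m x - u n x) < e / sqrt c"
      using Cauchy by metis
    have "dist (u m x) (u n x) < e" if "m \<ge> N" "n \<ge> N" for m n x
    proof -
      have "dist (u m x) (u n x) \<le> sqrt c * L2_norm \<mu> (\<lambda>x. u m x - u n x)"
        using cmod_le_L2_norm[OF diff[OF u[of m] u[of n]], of x] by (simp add: dist_norm)
      also have "\<dots> < e" using N[OF that] c_pos by (simp add: field_simps)
      finally show ?thesis .
    qed
    then show "\<exists>M. \<forall>x\<in>UNIV. \<forall>m\<ge>M. \<forall>n\<ge>M. dist (u m x) (u n x) < e" by blast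
  qed
  then obtain f where f: "uniform_limit UNIV u f sequentially"
    using Cauchy_uniformly_convergent unfolding uniformly_convergent_on_def by blast
  have cont: "continuous_on UNIV f"
    by (rule uniform_limit_theorem[OF _ f]) (simp_all add: continuous u)
  have lim: "(\<lambda>n. u n x) \<longlonglongrightarrow> f x" for x
    using tendsto_uniform_limitI[OF f] by simp
  \<comment> \<open>With \<open>m\<close> fixed, \<open>n\<close> tends to infinity in the Cauchy
    estimate.\<close>
  have tail: "\<exists>N. \<forall>m\<ge>N. (\<lambda>x. u m x - f x) \<in> L2 \<mu> \<and> L2_norm \<mu> (\<lambda>x. u m x - f x) \<le> e"
    if e: "e > 0" for e
  proof -
    obtain N where N: "\<And>m n. m \<ge> N \<Longrightarrow> n \<ge> N \<Longrightarrow> L2_norm \<mu> (\<lambda>x. u m x - u n x) < e"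
      using Cauchy[OF e] by metis
    have "(\<lambda>x. u m x - f x) \<in> L2 \<mu>" "L2_norm \<mu> (\<lambda>x. u m x - f x) \<le> e" if m: "m \<ge> N" for m
    proof -
      have "\<forall>\<^sub>F n in sequentially. L2_norm \<mu> (\<lambda>x. u m x - u n x) \<le> e"
        using N[OF m] by (intro eventually_sequentiallyI[of N]) (simp add: less_imp_le)
      moreover have "(\<lambda>x. u m x - u n x) \<in> L2 \<mu>" for n by (intro in_L2 diff u)
      moreover have "(\<lambda>n. u m x - u n x) \<longlonglongrightarrow> u m x - f x" for x
        by (intro tendsto_intros lim)
      ultimately show "(\<lambda>x. u m x - f x) \<in> L2 \<mu>" "L2_norm \<mu> (\<lambda>x. u m x - f x) \<le> e"
        using L2_pointwise_limit[of "\<lambda>n x. u m x - u n x" \<mu> "\<lambda>x. u m x - f x" e] e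
        by auto
    qed
    then show ?thesis by blast
  qed
  have to0: "(\<lambda>n. L2_norm \<mu> (\<lambda>x. u n x - f x)) \<longlonglongrightarrow> 0"
  proof (rule LIMSEQ_I)
    fix r :: real assume "r > 0"
    then show "\<exists>N. \<forall>n\<ge>N. norm (L2_norm \<mu> (\<lambda>x. u n x - f x) - 0) < r"
      using tail[of "r / 2"] by (fastforce)
  qed
  \<comment> \<open>Subtracting this difference from \<open>u m\<close> places \<open>f\<close> in
    \<open>L2\<close>. Closedness then yields an element of \<open>H\<close> equal to
    \<open>f\<close> almost everywhere, and continuity identifies the two.\<close>
  obtain m where "(\<lambda>x. u m x - f x) \<in> L2 \<mu>" using tail[of 1] by auto
  from L2_diff[OF in_L2[OF u[of m]] this] have "f \<in> L2 \<mu>" by simp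
  from closed[OF u this to0] obtain h where h: "h \<in> H" "AE x in \<mu>. h x = f x" by auto
  then have "h = f" using continuous_AE_eq_imp_eq[OF haar continuous cont] by simp
  then show thesis using that h to0 by simp
qed

text \<open>The representing element minimises \<open>\<parallel>f\<parallel>\<^sup>2 - 2 Re (\<phi> f)\<close>.\<close>

lemma Riesz_representation:
  assumes \<phi>_add: "\<And>f g. f \<in> H \<Longrightarrow> g \<in> H \<Longrightarrow> \<phi> (\<lambda>x. f x + g x) = \<phi> f + \<phi> g"
    and \<phi>_cmult: "\<And>a f. f \<in> H \<Longrightarrow> \<phi> (\<lambda>x. a * f x) = a * \<phi> f"
    and bounded: "\<And>f. f \<in> H \<Longrightarrow> cmod (\<phi> f) \<le> K * L2_norm \<mu> f"
  obtains g where "g \<in> H" "\<And>f. f \<in> H \<Longrightarrow> L2_inner \<mu> f g = \<phi> f"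
proof -
  define J where "J f = (L2_norm \<mu> f)\<^sup>2 - 2 * Re (\<phi> f)" for f
  \<comment> \<open>Completing the square in the norm of \<open>f\<close>.\<close>
  have "J f \<ge> - K\<^sup>2" if f: "f \<in> H" for f
  proof -
    have "Re (\<phi> f) \<le> K * L2_norm \<mu> f"
      using bounded[OF f] complex_Re_le_cmod order_trans by blast
    moreover have "0 \<le> (L2_norm \<mu> f - K)\<^sup>2" by simp
    ultimately show ?thesis unfolding J_def power2_diff by (simp add: mult.commute)
  qed
  then have bdd: "bdd_below (J ` H)" by (intro bdd_belowI2)
  define m where "m = Inf (J ` H)"
  have m_le: "m \<le> J f" if "f \<in> H" for f
    unfolding m_def using bdd that by (intro cInf_lower) auto
  \<comment> \<open>On a line \<open>J\<close> is a quadratic polynomial in \<open>t\<close>. This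
    serves twice: at midpoints, for the Cauchy property of a minimising sequence, and as the
    variation around the minimiser.\<close>
  have J_line: "J (\<lambda>x. u x + complex_of_real t * h x)
      = J u + 2 * t * (Re (L2_inner \<mu> u h) - Re (\<phi> h)) + t\<^sup>2 * (L2_norm \<mu> h)\<^sup>2"
    if "u \<in> H" "h \<in> H" for u h t
    using that unfolding J_def
    by (simp add: L2_norm_add_sq in_L2 cmult \<phi>_add \<phi>_cmult L2_inner_cmult_right L2_norm_cmult
        power_mult_distrib algebra_simps)
  \<comment> \<open>A parallelogram estimate: \<open>J\<close> is at least \<open>m\<close> at the
    midpoint of \<open>u\<close> and \<open>v\<close>, and comparing \<open>t = 1/2\<close> with
    \<open>t = 1\<close> eliminates the linear term.\<close>
  have close: "(L2_norm \<mu> (\<lambda>x. v x - u x))\<^sup>2 \<le> 2 * ((J u - m) + (J v - m))"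
    if u: "u \<in> H" and v: "v \<in> H" for u v
  proof -
    let ?d = "\<lambda>x. v x - u x"
    have d: "?d \<in> H" using u v by (rule diff[rotated])
    have "m \<le> J (\<lambda>x. u x + complex_of_real (1/2) * ?d x)" by (intro m_le add u cmult d)
    then show ?thesis
      using J_line[OF u d, of "1/2"] J_line[OF u d, of 1] by (simp add: power2_eq_square)
  qed
  have "\<exists>u\<in>H. J u < m + 1 / real (Suc n)" for n
  proof -
    have "J ` H \<noteq> {}" using zero by auto
    moreover have "Inf (J ` H) < m + 1 / real (Suc n)" unfolding m_def by simp
    ultimately have "\<exists>y\<in>J ` H. y < m + 1 / real (Suc n)" by (rule cInf_lessD)
    then show ?thesis by (simp only: bex_simps)
  qed
  then obtain u where u: "\<And>n. u n \<in> H" and Ju: "\<And>n. J (u n) < m + 1 / real (Suc n)" by metis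
  have "\<exists>N. \<forall>k\<ge>N. \<forall>n\<ge>N. L2_norm \<mu> (\<lambda>x. u k x - u n x) < e" if e: "e > 0" for e
  proof -
    \<comment> \<open>The estimate \<open>close\<close> doubles the sum of two errors, each to be
      kept below \<open>e^2 / 4\<close>.\<close>
    have "e\<^sup>2 / 4 > 0" using e by simp
    then obtain N where N: "1 / real (Suc N) < e\<^sup>2 / 4"
      using nat_approx_posE by blast
    have "L2_norm \<mu> (\<lambda>x. u k x - u n x) < e" if "k \<ge> N" "n \<ge> N" for k n
    proof -
      have "J (u i) < m + e\<^sup>2 / 4" if "i \<ge> N" for i
      proof -
        have "1 / real (Suc i) \<le> 1 / real (Suc N)" using that by (simp add: frac_le)
        then have "m + 1 / real (Suc i) < m + e\<^sup>2 / 4" using N by (simp only: add_less_cancel_left)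
        with Ju show ?thesis by (rule less_trans)
      qed
      then have "J (u k) < m + e\<^sup>2 / 4" "J (u n) < m + e\<^sup>2 / 4" using that by auto
      then have "2 * ((J (u n) - m) + (J (u k) - m)) < e\<^sup>2" by argo
      with close[OF u u] have "(L2_norm \<mu> (\<lambda>x. u k x - u n x))\<^sup>2 < e\<^sup>2"
        by (rule le_less_trans)
      then show ?thesis using e by (simp add: power2_less_imp_less[of _ e])
    qed
    then show ?thesis by blast
  qed
  then obtain g where g: "g \<in> H" and lim: "(\<lambda>n. L2_norm \<mu> (\<lambda>x. u n x - g x)) \<longlonglongrightarrow> 0"
    using complete[of u, OF u] by blast
  have Re_eq: "Re (L2_inner \<mu> g h) = Re (\<phi> h)" if h: "h \<in> H" for h
  proof -
    have "(\<lambda>n. L2_inner \<mu> (u n) h - L2_inner \<mu> g h) \<longlonglongrightarrow> 0"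
    proof (rule Lim_null_comparison)
      show "(\<lambda>n. L2_norm \<mu> (\<lambda>x. u n x - g x) * L2_norm \<mu> h) \<longlonglongrightarrow> 0"
        using tendsto_mult_right[OF lim] by simp
      show "\<forall>\<^sub>F n in sequentially. norm (L2_inner \<mu> (u n) h - L2_inner \<mu> g h)
          \<le> L2_norm \<mu> (\<lambda>x. u n x - g x) * L2_norm \<mu> h"
        using L2_Cauchy_Schwarz[OF in_L2[OF diff[OF u g]] in_L2[OF h]]
        by (simp add: L2_inner_diff_left in_L2 u g h)
    qed
    then have inner_lim: "(\<lambda>n. L2_inner \<mu> (u n) h) \<longlonglongrightarrow> L2_inner \<mu> g h"
      by (simp add: LIM_zero_iff)
    define a where "a = Re (L2_inner \<mu> g h) - Re (\<phi> h)"
    define b where "b = (L2_norm \<mu> h)\<^sup>2"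
    \<comment> \<open>\<open>J\<close> is at least \<open>m\<close> at \<open>u n + t * h\<close>
      and below \<open>m + 1 / Suc n\<close> at \<open>u n\<close>. The difference of the two values
      is the variation, whose limit is therefore nonnegative.\<close>
    have quad: "0 \<le> 2 * t * a + t\<^sup>2 * b" for t
    proof (rule LIMSEQ_le)
      show "(\<lambda>n. - (1 / real (Suc n))) \<longlonglongrightarrow> 0"
        using tendsto_minus[OF LIMSEQ_Suc[OF lim_1_over_n]] by simp
      show "(\<lambda>n. 2 * t * (Re (L2_inner \<mu> (u n) h) - Re (\<phi> h)) + t\<^sup>2 * b)
          \<longlonglongrightarrow> 2 * t * a + t\<^sup>2 * b"
        unfolding a_def by (intro tendsto_intros inner_lim)
      have "- (1 / real (Suc n)) \<le> 2 * t * (Re (L2_inner \<mu> (u n) h) - Re (\<phi> h)) + t\<^sup>2 * b" for n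
        using m_le[OF add[OF u cmult[OF h]], of n "complex_of_real t"] J_line[OF u h, of n t] Ju[of n]
        unfolding b_def by linarith
      then show "\<exists>N. \<forall>n\<ge>N. - (1 / real (Suc n))
          \<le> 2 * t * (Re (L2_inner \<mu> (u n) h) - Re (\<phi> h)) + t\<^sup>2 * b" by blast
    qed
    have "b \<ge> 0" by (simp add: b_def)
    have "a = 0"
    proof (rule ccontr)
      assume "a \<noteq> 0"
      \<comment> \<open>The quadratic at \<open>t = - a / (b + 1)\<close>, where it is negative for
        nonzero \<open>a\<close>; the 1 covers the case \<open>b = 0\<close>.\<close>
      have "2 * (- a / (b + 1)) * a + (- a / (b + 1))\<^sup>2 * b = - (a\<^sup>2 * (b + 2) / (b + 1)\<^sup>2)"
        using \<open>b \<ge> 0\<close> by (simp add: power2_eq_square divide_simps) (simp add: algebra_simps)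
      moreover have "a\<^sup>2 * (b + 2) / (b + 1)\<^sup>2 > 0" using \<open>a \<noteq> 0\<close> \<open>b \<ge> 0\<close> by simp
      ultimately show False using quad[of "- a / (b + 1)"] by simp
    qed
    then show ?thesis by (simp add: a_def)
  qed
  have "L2_inner \<mu> h g = \<phi> h" if h: "h \<in> H" for h
  proof (rule complex_eqI)
    show "Re (L2_inner \<mu> h g) = Re (\<phi> h)"
      using Re_eq[OF h] L2_inner_commute[of \<mu> h g] by simp
    \<comment> \<open>The imaginary part is the real-part identity for
      \<open>\<i> * h\<close>.\<close>
    show "Im (L2_inner \<mu> h g) = Im (\<phi> h)"
      using Re_eq[OF cmult[OF h, of \<i>]] L2_inner_commute[of \<mu> h g]
      by (simp add: L2_inner_cmult_right \<phi>_cmult h)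
  qed
  then show thesis using that g by blast
qed

section \<open>The reproducing kernel and convolution with it\<close>

lemma inner_eq_imp_eq:
  assumes f: "f \<in> H" and g: "g \<in> H" and eq: "\<And>h. h \<in> H \<Longrightarrow> L2_inner \<mu> h f = L2_inner \<mu> h g"
  shows "f = g"
proof -
  let ?d = "\<lambda>x. f x - g x"
  have d: "?d \<in> H" using f g by (rule diff)
  have "L2_inner \<mu> ?d ?d = 0"
    using eq[OF d] by (simp add: L2_inner_diff_right in_L2 d f g)
  then have "?d = (\<lambda>x. 0)" using norm_0_imp_zero[OF d] by (simp add: L2_inner_same)
  then show ?thesis by (metis (no_types) eq_iff_diff_eq_0 ext)
qed

text \<open>The reproducing kernel of \<open>H\<close> at the identity. Its existence comes from
  \<open>Riesz_representation\<close>, its uniqueness from \<open>inner_eq_imp_eq\<close>.\<close>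

definition kernel :: "'g \<Rightarrow> complex" where
  "kernel = (SOME S. S \<in> H \<and> (\<forall>f\<in>H. L2_inner \<mu> f S = f 0))"

lemma kernel_in: "kernel \<in> H" and inner_kernel: "f \<in> H \<Longrightarrow> L2_inner \<mu> f kernel = f 0"
proof -
  have "\<exists>S. S \<in> H \<and> (\<forall>f\<in>H. L2_inner \<mu> f S = f 0)"
    by (rule Riesz_representation[of "\<lambda>f. f 0" "sqrt c"]) (auto simp: cmod_le_L2_norm)
  then have "kernel \<in> H \<and> (\<forall>f\<in>H. L2_inner \<mu> f kernel = f 0)"
    unfolding kernel_def by (rule someI_ex)
  then show "kernel \<in> H" "f \<in> H \<Longrightarrow> L2_inner \<mu> f kernel = f 0" by auto
qed

text \<open>Left translation is unitary, so the translation by \<open>x\<close> can be moved from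
  the kernel to \<open>f\<close>, whose value at \<open>x\<close> becomes the value at the
  identity.\<close>

lemma reproducing:
  assumes f: "f \<in> H"
  shows "L2_inner \<mu> f (ltrans x kernel) = f x"
proof -
  have "ltrans x (ltrans (- x) f) = f" by (simp add: ltrans_ltrans) (simp add: ltrans_def)
  then have "L2_inner \<mu> f (ltrans x kernel) = L2_inner \<mu> (ltrans (- x) f) kernel"
    using L2_inner_ltrans[OF haar in_L2[OF translate[OF f]] in_L2[OF kernel_in], of x "- x"] by simp
  also have "\<dots> = f x" using inner_kernel[OF translate[OF f], of "- x"] by (simp add: ltrans_def)
  finally show ?thesis .
qed

text \<open>Both sides are inner products of \<open>kernel\<close> with
  \<open>ltrans x kernel\<close>, in opposite orders; the relation is Hermitian symmetry.\<close>

lemma kernel_uminus: "kernel (- x) = cnj (kernel x)"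
proof -
  have "kernel (- x) = ltrans x kernel 0" by (simp add: ltrans_def)
  also have "\<dots> = L2_inner \<mu> (ltrans x kernel) kernel"
    by (simp add: inner_kernel translate kernel_in)
  also have "\<dots> = cnj (L2_inner \<mu> kernel (ltrans x kernel))" by (rule L2_inner_commute)
  finally show ?thesis by (simp add: reproducing kernel_in)
qed

text \<open>By the symmetry of the kernel the two integrands agree pointwise. Hence \<open>f\<close>
  may lie outside \<open>H\<close>, as \<open>L2_conv_kernel\<close> requires.\<close>

lemma conv_kernel: "conv \<mu> f kernel x = L2_inner \<mu> f (ltrans x kernel)"
proof -
  have "cnj (ltrans x kernel y) = kernel (- y + x)" for y
    using kernel_uminus[of "- x + y"] by (simp add: ltrans_def minus_add)
  then show ?thesis by (simp add: conv_def L2_inner_def)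
qed

lemma kernel_sa_conv_idempotent: "sa_conv_idempotent \<mu> kernel"
  unfolding sa_conv_idempotent_def
  by (simp add: in_L2 kernel_in conv_kernel reproducing involution_def kernel_uminus)

lemma L2_conv_kernel: "L2_conv \<mu> kernel = H"
proof
  show "H \<subseteq> L2_conv \<mu> kernel"
  proof
    fix f assume f: "f \<in> H"
    then have "f = conv \<mu> f kernel" by (simp add: fun_eq_iff conv_kernel reproducing)
    then show "f \<in> L2_conv \<mu> kernel" unfolding L2_conv_def using in_L2[OF f] by blast
  qed
  show "L2_conv \<mu> kernel \<subseteq> H"
  proof
    fix k assume "k \<in> L2_conv \<mu> kernel"
    then obtain f where f: "f \<in> L2 \<mu>" and k: "k = conv \<mu> f kernel" by (auto simp: L2_conv_def)
    \<comment> \<open>\<open>p\<close> is the orthogonal projection of \<open>f\<close> to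
      \<open>H\<close>. The translated kernels lie in \<open>H\<close>, so their inner products with
      \<open>f\<close> and \<open>p\<close> agree.\<close>
    obtain p where p: "p \<in> H" "\<And>h. h \<in> H \<Longrightarrow> L2_inner \<mu> h p = L2_inner \<mu> h f"
    proof (rule Riesz_representation[of "\<lambda>h. L2_inner \<mu> h f" "L2_norm \<mu> f"])
      show "cmod (L2_inner \<mu> h f) \<le> L2_norm \<mu> f * L2_norm \<mu> h" if "h \<in> H" for h
        using L2_Cauchy_Schwarz[OF in_L2[OF that] f] by (simp add: mult.commute)
    qed (simp_all add: L2_inner_add_left L2_inner_cmult_left in_L2 f)
    have "k x = p x" for x
    proof -
      have "k x = cnj (L2_inner \<mu> (ltrans x kernel) f)"
        unfolding k conv_kernel by (rule L2_inner_commute)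
      also have "\<dots> = cnj (L2_inner \<mu> (ltrans x kernel) p)"
        by (simp add: p(2) translate kernel_in)
      also have "\<dots> = L2_inner \<mu> p (ltrans x kernel)" by (rule L2_inner_commute[symmetric])
      finally show ?thesis using p(1) by (simp add: reproducing)
    qed
    then show "k \<in> H" using p(1) by (metis ext)
  qed
qed

section \<open>The sampling expansion\<close>

text \<open>Polarisation of the sampling identity: real parts come from \<open>f + h\<close>,
  imaginary parts from replacing \<open>g\<close> by \<open>\<i> * g\<close>.\<close>

lemma has_sum_inner:
  assumes f: "f \<in> H" and g: "g \<in> H"
  shows "((\<lambda>\<gamma>. f \<gamma> * cnj (g \<gamma>)) has_sum c * L2_inner \<mu> f g) \<Gamma>"
proof -
  have Re: "((\<lambda>\<gamma>. Re (f \<gamma> * cnj (h \<gamma>))) has_sum c * Re (L2_inner \<mu> f h)) \<Gamma>"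
    if h: "h \<in> H" for h
  proof -
    have "((\<lambda>\<gamma>. (1/2) * ((cmod (f \<gamma> + h \<gamma>))\<^sup>2 + (- 1) * (cmod (f \<gamma>))\<^sup>2 + (- 1) * (cmod (h \<gamma>))\<^sup>2))
      has_sum (1/2) * (c * (L2_norm \<mu> (\<lambda>x. f x + h x))\<^sup>2 + (- 1) * (c * (L2_norm \<mu> f)\<^sup>2)
        + (- 1) * (c * (L2_norm \<mu> h)\<^sup>2))) \<Gamma>"
      by (intro has_sum_cmult_right has_sum_add has_sum_norm add f h)
    then show ?thesis
      by (simp add: L2_norm_add_sq in_L2 f h cmod_add_sq algebra_simps del: times_complex.sel)
  qed
  have Im_eq: "Im (f \<gamma> * cnj (g \<gamma>)) = Re (f \<gamma> * cnj (\<i> * g \<gamma>))" for \<gamma> by simp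
  have "((\<lambda>\<gamma>. complex_of_real (Re (f \<gamma> * cnj (g \<gamma>))) + \<i> * complex_of_real (Im (f \<gamma> * cnj (g \<gamma>))))
    has_sum complex_of_real (c * Re (L2_inner \<mu> f g))
      + \<i> * complex_of_real (c * Re (L2_inner \<mu> f (\<lambda>x. \<i> * g x)))) \<Gamma>"
    unfolding Im_eq
    by (intro has_sum_add has_sum_cmult_right has_sum_of_real Re g cmult)
  moreover have "complex_of_real (c * Re (L2_inner \<mu> f g))
      + \<i> * complex_of_real (c * Re (L2_inner \<mu> f (\<lambda>x. \<i> * g x))) = c * L2_inner \<mu> f g"
    by (simp add: L2_inner_cmult_right complex_eq_iff)
  moreover have "complex_of_real (Re z) + \<i> * complex_of_real (Im z) = z" for z
    by (simp add: complex_eq_iff)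
  ultimately show ?thesis by (simp only:)
qed

text \<open>The factors are grouped so as to match \<open>sinc_type\<close> for the function
  \<open>kernel / c\<close>.\<close>

definition partial_expansion :: "('g \<Rightarrow> complex) \<Rightarrow> 'g set \<Rightarrow> 'g \<Rightarrow> complex" where
  "partial_expansion f F = (\<lambda>x. \<Sum>\<gamma>\<in>F. f \<gamma> * (complex_of_real (1 / c) * kernel (- \<gamma> + x)))"

lemma partial_expansion_in: "finite F \<Longrightarrow> partial_expansion f F \<in> H"
  unfolding partial_expansion_def
  using translate[OF kernel_in] by (intro sum_closed cmult) (simp_all add: ltrans_def)

lemma inner_partial_expansion:
  assumes h: "h \<in> H" and F: "finite F"
  shows "L2_inner \<mu> h (partial_expansion f F) = (\<Sum>\<gamma>\<in>F. h \<gamma> * cnj (f \<gamma>)) / c"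
proof -
  have "L2_inner \<mu> h (partial_expansion f F)
      = (LINT x|\<mu>. (\<Sum>\<gamma>\<in>F. cnj (f \<gamma>) / c * (h x * cnj (ltrans \<gamma> kernel x))))"
    unfolding L2_inner_def partial_expansion_def ltrans_def
    by (simp add: sum_distrib_left mult_ac divide_inverse)
  also have "\<dots> = (\<Sum>\<gamma>\<in>F. cnj (f \<gamma>) / c * L2_inner \<mu> h (ltrans \<gamma> kernel))"
    unfolding L2_inner_def using integrable_mult_cnj_L2[OF in_L2[OF h] in_L2[OF translate[OF kernel_in]]]
    by (subst Bochner_Integration.integral_sum) simp_all
  finally show ?thesis by (simp add: reproducing[OF h] sum_divide_distrib mult.commute)
qed

text \<open>With \<open>h\<close> the remainder, \<open>c \<parallel>h\<parallel>\<^sup>2\<close> is the sum of \<open>h(\<gamma>) \<cdot> cnj (f(\<gamma>))\<close> outside \<open>F\<close>, and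
  AM-GM together with the sampling identity for \<open>h\<close> absorbs half of it.\<close>

lemma norm_remainder_le:
  assumes f: "f \<in> H" and F: "finite F" "F \<subseteq> \<Gamma>"
  shows "c * (L2_norm \<mu> (\<lambda>x. f x - partial_expansion f F x))\<^sup>2
    \<le> c * (L2_norm \<mu> f)\<^sup>2 - (\<Sum>\<gamma>\<in>F. (cmod (f \<gamma>))\<^sup>2)"
proof -
  define h where "h = (\<lambda>x. f x - partial_expansion f F x)"
  have h: "h \<in> H" unfolding h_def by (intro diff f partial_expansion_in F)
  have hh: "complex_of_real (c * (L2_norm \<mu> h)\<^sup>2)
      = c * L2_inner \<mu> h f - (\<Sum>\<gamma>\<in>F. h \<gamma> * cnj (f \<gamma>))"
  proof -
    have "L2_inner \<mu> h h = L2_inner \<mu> h f - L2_inner \<mu> h (partial_expansion f F)"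
      by (subst (2) h_def) (intro L2_inner_diff_right in_L2 h f partial_expansion_in F)
    then show ?thesis
      using c_pos by (simp add: L2_inner_same inner_partial_expansion[OF h F(1)] right_diff_distrib)
  qed
  have "((\<lambda>\<gamma>. h \<gamma> * cnj (f \<gamma>)) has_sum complex_of_real (c * (L2_norm \<mu> h)\<^sup>2)) (\<Gamma> - F)"
    unfolding hh by (intro has_sum_Diff has_sum_inner h f has_sum_finite F)
  from has_sum_Re[OF this]
  have "((\<lambda>\<gamma>. Re (h \<gamma> * cnj (f \<gamma>))) has_sum c * (L2_norm \<mu> h)\<^sup>2) (\<Gamma> - F)"
    by (simp only: Re_complex_of_real)
  moreover have "((\<lambda>\<gamma>. (1/2) * ((cmod (h \<gamma>))\<^sup>2 + (cmod (f \<gamma>))\<^sup>2)) has_sum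
      (1/2) * ((c * (L2_norm \<mu> h)\<^sup>2 - (\<Sum>\<gamma>\<in>F. (cmod (h \<gamma>))\<^sup>2))
        + (c * (L2_norm \<mu> f)\<^sup>2 - (\<Sum>\<gamma>\<in>F. (cmod (f \<gamma>))\<^sup>2)))) (\<Gamma> - F)"
    by (intro has_sum_cmult_right has_sum_add has_sum_Diff has_sum_norm h f has_sum_finite F)
  moreover have "Re (h \<gamma> * cnj (f \<gamma>)) \<le> (1/2) * ((cmod (h \<gamma>))\<^sup>2 + (cmod (f \<gamma>))\<^sup>2)" for \<gamma>
    using complex_Re_le_cmod[of "h \<gamma> * cnj (f \<gamma>)"] cmod_mult_cnj_le[of 1 "h \<gamma>" "f \<gamma>"] by simp
  ultimately have "c * (L2_norm \<mu> h)\<^sup>2 \<le> (1/2) * ((c * (L2_norm \<mu> h)\<^sup>2 - (\<Sum>\<gamma>\<in>F. (cmod (h \<gamma>))\<^sup>2))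
        + (c * (L2_norm \<mu> f)\<^sup>2 - (\<Sum>\<gamma>\<in>F. (cmod (f \<gamma>))\<^sup>2)))"
    by (rule has_sum_mono)
  moreover have "(\<Sum>\<gamma>\<in>F. (cmod (h \<gamma>))\<^sup>2) \<ge> 0" by (intro sum_nonneg) simp
  ultimately show ?thesis unfolding h_def by argo
qed

text \<open>The bound of \<open>norm_remainder_le\<close> is the tail of the sampling series of
  \<open>f\<close>, which tends to 0.\<close>

lemma remainder_tendsto_0:
  assumes f: "f \<in> H"
  shows "((\<lambda>F. L2_norm \<mu> (\<lambda>x. f x - partial_expansion f F x)) \<longlongrightarrow> 0) (finite_subsets_at_top \<Gamma>)"
proof -
  let ?r = "\<lambda>F. L2_norm \<mu> (\<lambda>x. f x - partial_expansion f F x)"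
  have "((\<lambda>F. (?r F)\<^sup>2) \<longlongrightarrow> 0) (finite_subsets_at_top \<Gamma>)"
  proof (rule tendsto_sandwich[where f = "\<lambda>_. 0"])
    have "((\<lambda>F. (c * (L2_norm \<mu> f)\<^sup>2 - (\<Sum>\<gamma>\<in>F. (cmod (f \<gamma>))\<^sup>2)) / c)
        \<longlongrightarrow> (c * (L2_norm \<mu> f)\<^sup>2 - c * (L2_norm \<mu> f)\<^sup>2) / c) (finite_subsets_at_top \<Gamma>)"
      using has_sum_norm[OF f] c_pos unfolding has_sum_def by (intro tendsto_intros) auto
    then show "((\<lambda>F. (c * (L2_norm \<mu> f)\<^sup>2 - (\<Sum>\<gamma>\<in>F. (cmod (f \<gamma>))\<^sup>2)) / c) \<longlongrightarrow> 0)
        (finite_subsets_at_top \<Gamma>)" by simp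
    show "\<forall>\<^sub>F F in finite_subsets_at_top \<Gamma>.
        (?r F)\<^sup>2 \<le> (c * (L2_norm \<mu> f)\<^sup>2 - (\<Sum>\<gamma>\<in>F. (cmod (f \<gamma>))\<^sup>2)) / c"
    proof (rule eventually_finite_subsets_at_top_weakI)
      fix F assume "finite F" "F \<subseteq> \<Gamma>"
      from norm_remainder_le[OF f this] c_pos
      show "(?r F)\<^sup>2 \<le> (c * (L2_norm \<mu> f)\<^sup>2 - (\<Sum>\<gamma>\<in>F. (cmod (f \<gamma>))\<^sup>2)) / c"
        by (simp add: pos_le_divide_eq mult.commute)
    qed
  qed simp_all
  from tendsto_real_sqrt[OF this] show ?thesis by simp
qed

lemma sinc_type_kernel: "sinc_type \<mu> \<Gamma> H (\<lambda>x. complex_of_real (1 / c) * kernel x)"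
  unfolding sinc_type_def
proof (intro conjI ballI)
  show "(\<lambda>x. complex_of_real (1 / c) * kernel x) \<in> H" by (intro cmult kernel_in)
next
  fix f assume f: "f \<in> H"
  show "((\<lambda>F. L2_norm \<mu> (\<lambda>x. f x
      - (\<Sum>\<gamma>\<in>F. f \<gamma> * (complex_of_real (1 / c) * kernel (- \<gamma> + x))))) \<longlongrightarrow> 0) (finite_subsets_at_top \<Gamma>)"
    using remainder_tendsto_0[OF f] by (simp add: partial_expansion_def)
  have "uniform_limit UNIV (partial_expansion f) f (finite_subsets_at_top \<Gamma>)"
  proof (rule uniform_limitI)
    fix e :: real assume "e > 0"
    then have e: "e / sqrt c > 0" using c_pos by simp
    \<comment> \<open>Membership of the partial expansion in \<open>H\<close>, and so the evaluation
      bound for the remainder, is available for finite \<open>F\<close>.\<close>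
    have "\<forall>\<^sub>F F in finite_subsets_at_top \<Gamma>. finite F"
      by (rule eventually_finite_subsets_at_top_weakI)
    with order_tendstoD(2)[OF remainder_tendsto_0[OF f] e]
    show "\<forall>\<^sub>F F in finite_subsets_at_top \<Gamma>. \<forall>x\<in>UNIV. dist (partial_expansion f F x) (f x) < e"
    proof eventually_elim
      case (elim F)
      show ?case
      proof
        fix x
        have "dist (partial_expansion f F x) (f x)
            \<le> sqrt c * L2_norm \<mu> (\<lambda>x. f x - partial_expansion f F x)"
          using cmod_le_L2_norm[OF diff[OF f partial_expansion_in[OF elim(2)]], of x]
          by (simp add: dist_norm norm_minus_commute)
        also have "\<dots> < e" using elim(1) c_pos by (simp add: field_simps)
        finally show "dist (partial_expansion f F x) (f x) < e" .
      qed
    qed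
  qed
  then show "uniform_limit UNIV (\<lambda>F x. \<Sum>\<gamma>\<in>F. f \<gamma> * (complex_of_real (1 / c) * kernel (- \<gamma> + x))) f
      (finite_subsets_at_top \<Gamma>)"
    by (simp add: partial_expansion_def[abs_def])
qed

lemma tight_frame_kernel: "tight_frame \<mu> H \<Gamma> (\<lambda>\<gamma>. ltrans \<gamma> kernel)"
  unfolding tight_frame_def
  using c_pos has_sum_norm by (auto simp: translate kernel_in reproducing intro!: exI[of _ c])

section \<open>Surjectivity of the restriction map\<close>

text \<open>Pairing samples with a square-summable \<open>a\<close> is a bounded functional on
  \<open>H\<close>. Orthogonality makes its representing element take the values
  \<open>d * a \<gamma>\<close> on \<open>\<Gamma>\<close>. The cases used are \<open>d = c\<close>
  and \<open>d = 1\<close>.\<close>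

lemma restriction_onto_if_orthogonal:
  fixes d :: real
  assumes "d \<noteq> 0" and orth: "\<And>\<gamma> \<gamma>'. \<gamma> \<in> \<Gamma> \<Longrightarrow> \<gamma>' \<in> \<Gamma> \<Longrightarrow>
      L2_inner \<mu> (ltrans \<gamma> kernel) (ltrans \<gamma>' kernel) = (if \<gamma> = \<gamma>' then d else 0)"
  shows "restriction_map \<Gamma> ` H = ell2 \<Gamma>"
proof
  show "restriction_map \<Gamma> ` H \<subseteq> ell2 \<Gamma>"
    using has_sum_imp_summable[OF has_sum_norm]
    by (auto simp: restriction_map_def ell2_def cong: summable_on_cong)
  show "ell2 \<Gamma> \<subseteq> restriction_map \<Gamma> ` H"
  proof
    fix a assume "a \<in> ell2 \<Gamma>"
    then have ext: "a \<in> extensional \<Gamma>" and a: "(\<lambda>\<gamma>. (cmod (a \<gamma>))\<^sup>2) summable_on \<Gamma>"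
      by (auto simp: ell2_def)
    define A where "A = (\<Sum>\<^sub>\<infinity>\<gamma>\<in>\<Gamma>. (cmod (a \<gamma>))\<^sup>2)"
    have A: "((\<lambda>\<gamma>. (cmod (a \<gamma>))\<^sup>2) has_sum A) \<Gamma>" "A \<ge> 0"
      using a by (auto simp: A_def intro: infsum_nonneg)
    define \<phi> where "\<phi> h = (\<Sum>\<^sub>\<infinity>\<gamma>\<in>\<Gamma>. h \<gamma> * cnj (a \<gamma>))" for h
    \<comment> \<open>With \<open>t = 1\<close> this gives absolute convergence of the pairing; with
      \<open>t\<close> optimised, the bound on the functional.\<close>
    have majorant: "((\<lambda>\<gamma>. (1/2) * (t * (cmod (h \<gamma>))\<^sup>2 + (1 / t) * (cmod (a \<gamma>))\<^sup>2))
        has_sum (1/2) * (t * (c * (L2_norm \<mu> h)\<^sup>2) + (1 / t) * A)) \<Gamma>" if "h \<in> H" for h t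
      by (intro has_sum_cmult_right has_sum_add has_sum_norm that A)
    have le: "cmod (h \<gamma> * cnj (a \<gamma>)) \<le> (1/2) * (t * (cmod (h \<gamma>))\<^sup>2 + (1 / t) * (cmod (a \<gamma>))\<^sup>2)"
      if "t > 0" for h \<gamma> t
      using cmod_mult_cnj_le[OF that, of "h \<gamma>" "a \<gamma>"] by simp
    have \<phi>: "((\<lambda>\<gamma>. h \<gamma> * cnj (a \<gamma>)) has_sum \<phi> h) \<Gamma>" if h: "h \<in> H" for h
    proof -
      have "(\<lambda>\<gamma>. cmod (h \<gamma> * cnj (a \<gamma>))) summable_on \<Gamma>"
      proof (rule Infinite_Sum.abs_summable_on_comparison_test')
        show "(\<lambda>\<gamma>. (1/2) * (1 * (cmod (h \<gamma>))\<^sup>2 + (1 / 1) * (cmod (a \<gamma>))\<^sup>2)) summable_on \<Gamma>"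
          using majorant[OF h, of 1] by (rule has_sum_imp_summable)
      qed (rule le[OF zero_less_one])
      then show ?thesis unfolding \<phi>_def by (rule has_sum_infsum[OF Infinite_Sum.abs_summable_summable])
    qed
    obtain g where g: "g \<in> H" "\<And>h. h \<in> H \<Longrightarrow> L2_inner \<mu> h g = \<phi> h"
    proof (rule Riesz_representation[of \<phi> "sqrt c * sqrt A"])
      fix h k assume h: "h \<in> H" and k: "k \<in> H"
      have "((\<lambda>\<gamma>. (h \<gamma> + k \<gamma>) * cnj (a \<gamma>)) has_sum \<phi> h + \<phi> k) \<Gamma>"
        using has_sum_add[OF \<phi>[OF h] \<phi>[OF k]] by (simp add: distrib_right)
      then show "\<phi> (\<lambda>x. h x + k x) = \<phi> h + \<phi> k" using \<phi>[OF add[OF h k]] has_sum_unique by blast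
    next
      fix z h assume h: "h \<in> H"
      have "((\<lambda>\<gamma>. (z * h \<gamma>) * cnj (a \<gamma>)) has_sum z * \<phi> h) \<Gamma>"
        using has_sum_cmult_right[OF \<phi>[OF h], of z] by (simp add: mult.assoc)
      then show "\<phi> (\<lambda>x. z * h x) = z * \<phi> h" using \<phi>[OF cmult[OF h]] has_sum_unique by blast
    next
      fix h assume h: "h \<in> H"
      have "cmod (\<phi> h) \<le> (sqrt c * L2_norm \<mu> h) * sqrt A"
      proof (rule le_mult_if_le_weighted_squares)
        fix t :: real assume t: "t > 0"
        have "cmod (\<phi> h) \<le> (1/2) * (t * (c * (L2_norm \<mu> h)\<^sup>2) + (1 / t) * A)"
          by (rule norm_infsum_le[OF \<phi>[OF h] majorant[OF h]]) (rule le[OF t])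
        then show "2 * cmod (\<phi> h) \<le> t * (sqrt c * L2_norm \<mu> h)\<^sup>2 + (sqrt A)\<^sup>2 / t"
          using c_pos A(2) by (simp add: power_mult_distrib)
      qed (use c_pos A(2) in simp_all)
      then show "cmod (\<phi> h) \<le> sqrt c * sqrt A * L2_norm \<mu> h" by (simp add: mult_ac)
    qed blast
    have val: "g \<gamma> = d * a \<gamma>" if \<gamma>: "\<gamma> \<in> \<Gamma>" for \<gamma>
    proof -
      have k: "ltrans \<gamma> kernel \<in> H" by (intro translate kernel_in)
      \<comment> \<open>The samples of a translated kernel are Gram matrix entries, so its pairing
        with \<open>a\<close> collapses to one term.\<close>
      have "ltrans \<gamma> kernel \<gamma>' = (if \<gamma> = \<gamma>' then d else 0)" if "\<gamma>' \<in> \<Gamma>" for \<gamma>'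
        using orth[OF \<gamma> that] by (simp add: reproducing k)
      then have "((\<lambda>\<gamma>'. ltrans \<gamma> kernel \<gamma>' * cnj (a \<gamma>')) has_sum d * cnj (a \<gamma>)) \<Gamma>"
        using \<gamma> by (intro has_sum_finite_neutralI[of "{\<gamma>}"]) auto
      then have "d * cnj (a \<gamma>) = L2_inner \<mu> (ltrans \<gamma> kernel) g"
        using \<phi>[OF k] g(2)[OF k] has_sum_unique by metis
      also have "\<dots> = cnj (g \<gamma>)"
        using L2_inner_commute[of \<mu> "ltrans \<gamma> kernel" g] by (simp add: reproducing g(1))
      finally have "cnj (d * cnj (a \<gamma>)) = g \<gamma>" by simp
      then show ?thesis by simp
    qed
    have "a = restriction_map \<Gamma> (\<lambda>x. (1 / d) * g x)"
    proof (rule extensionalityI[OF ext])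
      fix \<gamma> assume "\<gamma> \<in> \<Gamma>"
      then show "a \<gamma> = restriction_map \<Gamma> (\<lambda>x. (1 / d) * g x) \<gamma>"
        using \<open>d \<noteq> 0\<close> val by (simp add: restriction_map_def)
    qed (simp add: restriction_map_def)
    then show "a \<in> restriction_map \<Gamma> ` H" using cmult[OF g(1)] by blast
  qed
qed

text \<open>A function of \<open>H\<close> restricting to the indicator of \<open>{\<gamma>}\<close> represents, up to the factor \<open>c\<close>,
  evaluation at \<open>\<gamma>\<close>, so it is a multiple of the translated kernel.\<close>

lemma orthogonal_if_restriction_onto:
  assumes onto: "restriction_map \<Gamma> ` H = ell2 \<Gamma>" and \<gamma>: "\<gamma> \<in> \<Gamma>" and \<gamma>': "\<gamma>' \<in> \<Gamma>"
  shows "L2_inner \<mu> (ltrans \<gamma> kernel) (ltrans \<gamma>' kernel) = (if \<gamma> = \<gamma>' then c else 0)"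
proof -
  define \<delta> where "\<delta> = restrict (\<lambda>x. if x = \<gamma> then 1 else 0 :: complex) \<Gamma>"
  have "((\<lambda>i. (cmod (\<delta> i))\<^sup>2) has_sum 1) \<Gamma>"
    using \<gamma> by (intro has_sum_finite_neutralI[of "{\<gamma>}"]) (auto simp: \<delta>_def)
  moreover have "\<delta> \<in> extensional \<Gamma>" by (simp add: \<delta>_def)
  ultimately have "\<delta> \<in> ell2 \<Gamma>" unfolding ell2_def by (auto dest: has_sum_imp_summable)
  then have "\<delta> \<in> restriction_map \<Gamma> ` H" unfolding onto .
  then obtain f where f: "f \<in> H" and \<delta>: "\<delta> = restriction_map \<Gamma> f" by blast
  have f_val: "f x = (if x = \<gamma> then 1 else 0)" if "x \<in> \<Gamma>" for x
    using fun_cong[OF \<delta>, of x] that by (simp add: \<delta>_def restriction_map_def)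
  have k: "ltrans \<gamma> kernel \<in> H" by (intro translate kernel_in)
  have "(\<lambda>x. complex_of_real c * f x) = ltrans \<gamma> kernel"
  proof (rule inner_eq_imp_eq[OF cmult[OF f] k])
    fix h assume h: "h \<in> H"
    have "((\<lambda>x. h x * cnj (f x)) has_sum h \<gamma>) \<Gamma>"
      using \<gamma> by (intro has_sum_finite_neutralI[of "{\<gamma>}"]) (auto simp: f_val)
    with has_sum_inner[OF h f] have "c * L2_inner \<mu> h f = h \<gamma>" by (rule has_sum_unique)
    then show "L2_inner \<mu> h (\<lambda>x. complex_of_real c * f x) = L2_inner \<mu> h (ltrans \<gamma> kernel)"
      by (simp add: L2_inner_cmult_right reproducing h)
  qed
  \<comment> \<open>The value of \<open>ltrans \<gamma> kernel\<close> at \<open>\<gamma>'\<close>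
    is the inner product in question.\<close>
  from fun_cong[OF this, of \<gamma>'] have "ltrans \<gamma> kernel \<gamma>' = c * f \<gamma>'" by simp
  then show ?thesis by (simp add: reproducing k f_val[OF \<gamma>'])
qed

text \<open>Surjectivity makes the Gram matrix of the translates \<open>c\<close> times the
  identity, whence the factor \<open>1 / sqrt c\<close>; density is the sampling expansion.
  Conversely, orthonormality returns this Gram matrix and
  \<open>restriction_onto_if_orthogonal\<close> applies.\<close>

lemma restriction_onto_iff_orthonormal_basis:
  "restriction_map \<Gamma> ` H = ell2 \<Gamma> \<longleftrightarrow>
     orthonormal_basis \<mu> H \<Gamma> (\<lambda>\<gamma> x. complex_of_real (1 / sqrt c) * ltrans \<gamma> kernel x)"
  (is "_ \<longleftrightarrow> orthonormal_basis \<mu> H \<Gamma> ?e")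
proof -
  have sqrt_sqrt: "complex_of_real (sqrt c) * complex_of_real (sqrt c) = c"
    using c_pos by (simp flip: of_real_mult)
  have inner_e: "L2_inner \<mu> (?e \<gamma>) (?e \<gamma>')
      = L2_inner \<mu> (ltrans \<gamma> kernel) (ltrans \<gamma>' kernel) / c" for \<gamma> \<gamma>'
    unfolding L2_inner_cmult_left L2_inner_cmult_right by (simp add: sqrt_sqrt[symmetric])
  show ?thesis
  proof
    assume onto: "restriction_map \<Gamma> ` H = ell2 \<Gamma>"
    show "orthonormal_basis \<mu> H \<Gamma> ?e"
      unfolding orthonormal_basis_def
    proof (intro conjI ballI allI impI)
      show "?e \<gamma> \<in> H" for \<gamma> by (intro cmult translate kernel_in)
      show "L2_inner \<mu> (?e \<gamma>) (?e \<gamma>') = (if \<gamma> = \<gamma>' then 1 else 0)" if "\<gamma> \<in> \<Gamma>" "\<gamma>' \<in> \<Gamma>" for \<gamma> \<gamma>'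
        unfolding inner_e orthogonal_if_restriction_onto[OF onto that] using c_pos by simp
    next
      fix f and \<epsilon> :: real assume f: "f \<in> H" and "\<epsilon> > 0"
      from order_tendstoD(2)[OF remainder_tendsto_0[OF f] this(2)]
      obtain F where F: "finite F" "F \<subseteq> \<Gamma>" "L2_norm \<mu> (\<lambda>x. f x - partial_expansion f F x) < \<epsilon>"
        unfolding eventually_finite_subsets_at_top by blast
      have "partial_expansion f F x = (\<Sum>\<gamma>\<in>F. f \<gamma> / sqrt c * ?e \<gamma> x)" for x
        unfolding partial_expansion_def
        by (intro sum.cong refl) (simp add: ltrans_def sqrt_sqrt[symmetric])
      then show "\<exists>F a. finite F \<and> F \<subseteq> \<Gamma> \<and> L2_norm \<mu> (\<lambda>x. f x - (\<Sum>\<gamma>\<in>F. a \<gamma> * ?e \<gamma> x)) < \<epsilon>"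
        using F by (intro exI[of _ F] exI[of _ "\<lambda>\<gamma>. f \<gamma> / sqrt c"]) simp
    qed
  next
    assume "orthonormal_basis \<mu> H \<Gamma> ?e"
    then have "L2_inner \<mu> (?e \<gamma>) (?e \<gamma>') = (if \<gamma> = \<gamma>' then 1 else 0)" if "\<gamma> \<in> \<Gamma>" "\<gamma>' \<in> \<Gamma>" for \<gamma> \<gamma>'
      using that unfolding orthonormal_basis_def by blast
    then have "L2_inner \<mu> (ltrans \<gamma> kernel) (ltrans \<gamma>' kernel) = c * (if \<gamma> = \<gamma>' then 1 else 0)"
      if "\<gamma> \<in> \<Gamma>" "\<gamma>' \<in> \<Gamma>" for \<gamma> \<gamma>'
      using that c_pos unfolding inner_e by (simp add: divide_eq_eq)
    then show "restriction_map \<Gamma> ` H = ell2 \<Gamma>"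
      using c_pos by (intro restriction_onto_if_orthogonal[of c]) auto
  qed
qed

end

text \<open>If the restriction map is onto, each translate \<open>ltrans \<gamma> S\<close> with
  \<open>\<gamma>\<close> in \<open>\<Gamma>\<close> has squared norm \<open>c\<close>. The
  equivalence is therefore stated for the translates divided by \<open>sqrt c\<close>, and for the
  unscaled ones when \<open>c = 1\<close>.\<close>

theorem theorem2p5:
  fixes \<mu> :: "'g::{topological_group_add,t2_space} measure"
    and \<Gamma> :: "'g set" and H :: "('g \<Rightarrow> complex) set" and c :: real
  assumes "locally_compact_space (euclidean :: 'g topology)"
    and "left_haar_measure \<mu>"
    and "unimodular \<mu>"
    and "closed_left_invariant_continuous \<mu> H"
    and "c > 0"
    and "sampling_identity \<mu> \<Gamma> H c"
  shows "sampling_space \<mu> \<Gamma> H \<and>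
    (\<exists>S. sa_conv_idempotent \<mu> S \<and>
         sinc_type \<mu> \<Gamma> H (\<lambda>x. complex_of_real (1 / c) * S x) \<and>
         H = L2_conv \<mu> S \<and>
         (\<forall>f\<in>H. \<forall>\<gamma>\<in>\<Gamma>. f \<gamma> = L2_inner \<mu> f (ltrans \<gamma> S)) \<and>
         tight_frame \<mu> H \<Gamma> (\<lambda>\<gamma>. ltrans \<gamma> S) \<and>
         (restriction_map \<Gamma> ` H = ell2 \<Gamma> \<longleftrightarrow>
            orthonormal_basis \<mu> H \<Gamma> (\<lambda>\<gamma> x. complex_of_real (1 / sqrt c) * ltrans \<gamma> S x)) \<and>
         (orthonormal_basis \<mu> H \<Gamma> (\<lambda>\<gamma>. ltrans \<gamma> S) \<longrightarrow> restriction_map \<Gamma> ` H = ell2 \<Gamma>) \<and>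
         (c = 1 \<longrightarrow>
            (restriction_map \<Gamma> ` H = ell2 \<Gamma> \<longleftrightarrow> orthonormal_basis \<mu> H \<Gamma> (\<lambda>\<gamma>. ltrans \<gamma> S))))"
proof -
  interpret sampled_subspace \<mu> \<Gamma> H c
    using assms by unfold_locales
  have space: "sampling_space \<mu> \<Gamma> H"
    unfolding sampling_space_def using subspace c_pos sampling sinc_type_kernel by blast
  have onto_if_basis: "restriction_map \<Gamma> ` H = ell2 \<Gamma>"
    if "orthonormal_basis \<mu> H \<Gamma> (\<lambda>\<gamma>. ltrans \<gamma> kernel)"
    using that unfolding orthonormal_basis_def
    by (intro restriction_onto_if_orthogonal[of 1]) simp_all
  have c_1: "restriction_map \<Gamma> ` H = ell2 \<Gamma> \<longleftrightarrow> orthonormal_basis \<mu> H \<Gamma> (\<lambda>\<gamma>. ltrans \<gamma> kernel)"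
    if "c = 1"
    using restriction_onto_iff_orthonormal_basis that by simp
  show ?thesis
    using space kernel_sa_conv_idempotent sinc_type_kernel L2_conv_kernel tight_frame_kernel
      restriction_onto_iff_orthonormal_basis onto_if_basis c_1
    by (intro conjI exI[of _ kernel]) (simp_all add: reproducing)
qed

end
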